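(* Assume $\lVert I-M^{-1}A\rVert_B<1$. Let $$\widehat M^{-1}B = V\,\mathrm{diag}(\mu_1,\dots,\mu_n)\,V^{-1}$$ be a $B$-unitary diagonalization of $\widehat M^{-1}B$ with sorted eigenvalues $\mu_1\le\dots\le\mu_n$ and corresponding $B$-unitary eigenvector matrix $V=[v_1\ \cdots\ v_n]$. Let $\hat P,\hat R\in\mathbb{C}^{n\times n_c}$ be such that $$\mathcal R(\hat P)=\mathcal R([v_1\ \cdots\ v_{n_c}])\quad\text{and}\quad \mathcal N(\hat R^HA)=\mathcal R([v_{n_c+1}\ \cdots\ v_n]).$$ Put $P_*=B^{-1}A^H\hat R$ and $R_*=A^{-H}B\hat P$. Then for $(\nu_1,\nu_2)\in\{(0,1),(1,0),(1,1)\}$, $$\lVert E_+^{\nu_1,\nu_2}(\hat P,\hat R)\rVert_B^2=\lVert E_+^{\nu_1,\nu_2}(P_*,\hat R)\rVert_B^2=\lVert E_+^{\nu_1,\nu_2}(\hat P,R_* )\rVert_B^2=(1-\mu_{n_c+1})^{\nu_1+\nu_2}<1.$$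
   Context: $A,M\in\mathbb{C}^{n\times n}$ are nonsingular, $B\in\mathbb{C}^{n\times n}$ is Hermitian positive definite (HPD), and $1\le n_c<n$. $\mathcal R(\cdot)$ and $\mathcal N(\cdot)$ denote range and kernel, and $A^{-H}=(A^H)^{-1}$. The $B$-norm is $\lVert x\rVert_B=\sqrt{x^HBx}$ on vectors, and $\lVert C\rVert_B=\sup_{x\ne0}\lVert Cx\rVert_B/\lVert x\rVert_B$ on matrices. The $B$-adjoint of $C\in\mathbb{C}^{n\times n}$ is $C^+=B^{-1}C^HB$. A matrix $V\in\mathbb{C}^{n\times n}$ is $B$-unitary if $V^HBV=I_n$; a $B$-unitary diagonalization of $C$ is $C=VDV^{-1}$ with $V$ $B$-unitary and $D$ diagonal. $\widehat M^{-1}$ denotes the matrix $\widehat M^{-1}=M^{-1}AB^{-1}+B^{-1}A^HM^{-H}-M^{-1}AB^{-1}A^HM^{-H}$, so that $\widehat M^{-1}B=M^{-1}A+(M^{-1}A)^+-M^{-1}A(M^{-1}A)^+$ (a $B$-self-adjoint matrix, with real eigenvalues). For $P,R\in\mathbb{C}^{n\times n_c}$ with $R^HAP$ nonsingular, $\Pi_A(P,R)=P(R^HAP)^{-1}R^HA$, and for $\nu_1,\nu_2\in\mathbb{N}_0$, $E_+^{\nu_1,\nu_2}(P,R)=(I-(M^{-1}A)^+)^{\nu_2}(I-\Pi_A(P,R))(I-M^{-1}A)^{\nu_1}$. *)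

theory Defs
  imports
    "HOL-Analysis.Analysis"
    "Jordan_Normal_Form.Schur_Decomposition"
    "Jordan_Normal_Form.Matrix_Kernel"
begin

hide_const (open) Finite_Cartesian_Product.mat Finite_Cartesian_Product.vec
no_notation Inner_Product.inner (infix "\<bullet>" 70)
no_notation Finite_Cartesian_Product.vec_nth (infixl "$" 90)

(* Only meaningful for nonsingular A; unspecified otherwise. *)
definition minv :: "complex mat \<Rightarrow> complex mat" where
  "minv A = the (mat_inverse A)"

lemma minv_inverts:
  assumes "invertible_mat A"
  shows "minv A \<in> carrier_mat (dim_row A) (dim_row A)"
    and "A * minv A = 1\<^sub>m (dim_row A)"
    and "minv A * A = 1\<^sub>m (dim_row A)"
proof -
  define n where "n = dim_row A"
  have A: "A \<in> carrier_mat n n"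
    using conjunct1[OF assms[unfolded invertible_mat_def]]
    unfolding n_def square_mat.simps by (rule carrier_matI[OF refl])
  obtain C where C: "A * C = 1\<^sub>m n" "C * A = 1\<^sub>m (dim_row C)"
    using assms unfolding invertible_mat_def inverts_mat_def n_def by blast
  have "dim_col C = n" using arg_cong[OF C(1), of dim_col] by simp
  moreover have dr: "dim_row C = n" using arg_cong[OF C(2), of dim_col] A by simp
  ultimately have C': "C \<in> carrier_mat n n" by (rule_tac carrier_matI)
  have "A \<in> Units (ring_mat TYPE(complex) n ())"
    unfolding Units_def ring_mat_simps mem_Collect_eq
    using A C' C(1) C(2)[unfolded dr] by blast
  then obtain D where D: "mat_inverse A = Some D"
    using mat_inverse(1)[OF A, of "()"] by (cases "mat_inverse A") blast+
  have m: "minv A = D" unfolding minv_def D by (rule option.sel)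
  show "minv A \<in> carrier_mat (dim_row A) (dim_row A)" "A * minv A = 1\<^sub>m (dim_row A)"
    "minv A * A = 1\<^sub>m (dim_row A)"
    unfolding m n_def[symmetric] using mat_inverse(2)[OF A D] by blast+
qed

definition mat_range :: "complex mat \<Rightarrow> complex vec set" where
  "mat_range A = (\<lambda>x. A *\<^sub>v x) ` carrier_vec (dim_col A)"

(* The library's v \<bullet>c w conjugates its second argument, so (B x) \<bullet>c x is x^H B x;
   it is real when B is Hermitian, so Re loses nothing. *)
definition hermitian_posdef :: "complex mat \<Rightarrow> bool" where
  "hermitian_posdef B \<longleftrightarrow> square_mat B \<and> mat_adjoint B = B \<and>
     (\<forall>x \<in> carrier_vec (dim_row B). x \<noteq> 0\<^sub>v (dim_row B) \<longrightarrow> 0 < Re ((B *\<^sub>v x) \<bullet>c x))"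

definition Bnorm_vec :: "complex mat \<Rightarrow> complex vec \<Rightarrow> real" where
  "Bnorm_vec B x = sqrt (Re ((B *\<^sub>v x) \<bullet>c x))"

definition Bnorm :: "complex mat \<Rightarrow> complex mat \<Rightarrow> real" where
  "Bnorm B C =
     (SUP x \<in> carrier_vec (dim_col C) - {0\<^sub>v (dim_col C)}. Bnorm_vec B (C *\<^sub>v x) / Bnorm_vec B x)"

definition B_adjoint :: "complex mat \<Rightarrow> complex mat \<Rightarrow> complex mat" where
  "B_adjoint B C = minv B * mat_adjoint C * B"

definition B_unitary :: "complex mat \<Rightarrow> complex mat \<Rightarrow> bool" where
  "B_unitary B V \<longleftrightarrow> V \<in> carrier_mat (dim_row B) (dim_row B) \<and>
     mat_adjoint V * B * V = 1\<^sub>m (dim_row B)"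

definition B_unitary_diagonalization ::
    "complex mat \<Rightarrow> complex mat \<Rightarrow> complex mat \<Rightarrow> complex mat \<Rightarrow> bool" where
  "B_unitary_diagonalization B C V D \<longleftrightarrow> B_unitary B V \<and>
     D \<in> carrier_mat (dim_row B) (dim_row B) \<and> diagonal_mat D \<and> C = V * D * minv V"

definition M_hat_inv :: "complex mat \<Rightarrow> complex mat \<Rightarrow> complex mat \<Rightarrow> complex mat" where
  "M_hat_inv A M B =
     minv M * A * minv B + minv B * mat_adjoint A * minv (mat_adjoint M)
     - minv M * A * minv B * mat_adjoint A * minv (mat_adjoint M)"

definition cgc_proj :: "complex mat \<Rightarrow> complex mat \<Rightarrow> complex mat \<Rightarrow> complex mat" where
  "cgc_proj A P R = P * minv (mat_adjoint R * A * P) * mat_adjoint R * A"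

definition E_plus ::
    "complex mat \<Rightarrow> complex mat \<Rightarrow> complex mat \<Rightarrow> nat \<Rightarrow> nat \<Rightarrow> complex mat \<Rightarrow> complex mat \<Rightarrow> complex mat" where
  "E_plus A M B \<nu>1 \<nu>2 P R =
     (let n = dim_row A in
      ((1\<^sub>m n - B_adjoint B (minv M * A)) ^\<^sub>m \<nu>2)
      * (1\<^sub>m n - cgc_proj A P R)
      * ((1\<^sub>m n - minv M * A) ^\<^sub>m \<nu>1))"

end

theory Submission
  imports Defs
begin

text \<open>Write \<open>G = I - M\<^sup>-\<^sup>1A\<close>, so that \<open>I - M_hat_inv A M B * B = G G\<^sup>+\<close>. All three pairs of transfer operators
  give the same coarse-grid correction, namely the \<open>B\<close>-orthogonal projector onto the span of the first
  \<open>n\<^sub>c\<close> columns of \<open>V\<close>. In the \<open>B\<close>-orthonormal coordinates of \<open>V\<close>, where \<open>B\<close>-adjoints become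
  conjugate transposes, let \<open>K\<close> represent \<open>G\<close> and let \<open>S\<close> be the diagonal projector onto the last coordinates.
  With \<open>T = S K\<close>, the three error propagators become \<open>T\<^sup>H\<close>, \<open>T\<close> and \<open>T\<^sup>H T\<close>, and
  \<open>T T\<^sup>H\<close> is diagonal with largest entry \<open>1 - \<mu> n\<^sub>c\<close> (indices start at 0). The case without coarse-grid
  correction identifies \<open>1 - \<mu> 0\<close> with the squared \<open>B\<close>-norm of \<open>G\<close>, which is below 1.\<close>

section \<open>Matrix products, conjugate transposes and inverses\<close>

text \<open>Side conditions on dimensions alone, with no carrier size to guess, let the simplifier
  reassociate long products of rectangular matrices.\<close>

lemma assoc_mult_mat_dim:
  "dim_col A = dim_row B \<Longrightarrow> dim_col B = dim_row C \<Longrightarrow> A * B * C = A * (B * C)"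
  by (rule assoc_mult_mat) auto

lemma assoc_mult_mat_vec_dim:
  "dim_col A = dim_row B \<Longrightarrow> dim_col B = dim_vec v \<Longrightarrow> A * B *\<^sub>v v = A *\<^sub>v (B *\<^sub>v v)"
  by (rule assoc_mult_mat_vec) (auto intro: carrier_vecI)

lemma mult_mat_vec_unit:
  "j < dim_col A \<Longrightarrow> A *\<^sub>v unit_vec (dim_col A) j = col (A :: complex mat) j"
  by (metis col_mult2 col_one carrier_matI one_carrier_mat right_mult_one_mat)

lemma dim_mat_adjoint [simp]:
  "dim_row (mat_adjoint A) = dim_col A" "dim_col (mat_adjoint A) = dim_row A"
  by (simp_all add: mat_adjoint_def)

lemma mat_adjoint_index [simp]:
  "i < dim_col A \<Longrightarrow> j < dim_row A \<Longrightarrow> mat_adjoint A $$ (i, j) = conjugate (A $$ (j, i))"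
  by (simp add: mat_adjoint_def mat_of_rows_def)

lemma mat_adjoint_carrier [simp]:
  "A \<in> carrier_mat n m \<Longrightarrow> mat_adjoint A \<in> carrier_mat m n"
  by (rule carrier_matI) auto

lemma mat_adjoint_adjoint [simp]: "mat_adjoint (mat_adjoint (A :: complex mat)) = A"
  by (rule eq_matI) auto

lemma mat_adjoint_mult:
  assumes "(A :: complex mat) \<in> carrier_mat n m" and "B \<in> carrier_mat m k"
  shows "mat_adjoint (A * B) = mat_adjoint B * mat_adjoint A"
  using assms by (intro eq_matI) (auto simp: scalar_prod_def mult.commute intro!: sum.cong)

lemma mat_adjoint_one [simp]: "mat_adjoint (1\<^sub>m n :: complex mat) = 1\<^sub>m n"
  by (rule eq_matI) auto

lemma mat_adjoint_minus:
  assumes "(A :: complex mat) \<in> carrier_mat n m" and "B \<in> carrier_mat n m"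
  shows "mat_adjoint (A - B) = mat_adjoint A - mat_adjoint B"
  using assms by (intro eq_matI) auto

lemma mat_adjoint_diag_real:
  "mat_adjoint (mat_diag n (\<lambda>i. complex_of_real (f i))) = mat_diag n (\<lambda>i. complex_of_real (f i))"
  by (rule eq_matI) (auto simp: mat_diag_def)

lemma cscalar_prod_mat_adjoint:
  assumes A: "(A :: complex mat) \<in> carrier_mat n m" and x: "x \<in> carrier_vec m" and y: "y \<in> carrier_vec n"
  shows "(A *\<^sub>v x) \<bullet>c y = x \<bullet>c (mat_adjoint A *\<^sub>v y)"
proof -
  have "(A *\<^sub>v x) \<bullet>c y = (\<Sum>i<n. \<Sum>j<m. A $$ (i, j) * x $ j * cnj (y $ i))"
    using A x y by (auto simp: scalar_prod_def sum_distrib_right lessThan_atLeast0 intro!: sum.cong)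
  also have "\<dots> = (\<Sum>j<m. \<Sum>i<n. A $$ (i, j) * x $ j * cnj (y $ i))" by (rule sum.swap)
  also have "\<dots> = x \<bullet>c (mat_adjoint A *\<^sub>v y)"
    using A x y by (auto simp: scalar_prod_def sum_distrib_left lessThan_atLeast0 intro!: sum.cong)
  finally show ?thesis .
qed

text \<open>A one-sided inverse of a square matrix is two-sided, so a single product identity yields
  both invertibility and the value of \<open>minv\<close>.\<close>

lemma minv_eqI:
  assumes A: "A \<in> carrier_mat n n" and C: "C \<in> carrier_mat n n" and AC: "A * C = 1\<^sub>m n"
  shows "invertible_mat A" and "minv A = C"
proof -
  have CA: "C * A = 1\<^sub>m n" by (rule mat_mult_left_right_inverse[OF A C AC])
  show inv: "invertible_mat A"
    unfolding invertible_mat_def inverts_mat_def using A C AC CA by auto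
  note m = minv_inverts[OF inv]
  have mc: "minv A \<in> carrier_mat n n" using m(1) A by auto
  have "minv A = minv A * (A * C)" using mc AC by simp
  also have "\<dots> = (minv A * A) * C" using mc A C by simp
  also have "\<dots> = C" using m(3) A C by simp
  finally show "minv A = C" .
qed

section \<open>Euclidean norms and the operator norm induced by B\<close>

lemma vec_cnorm_eq_sum:
  assumes "y \<in> carrier_vec n"
  shows "Re (y \<bullet>c y) = (\<Sum>i<n. (cmod (y $ i))\<^sup>2)"
  using assms by (auto simp: scalar_prod_def lessThan_atLeast0 complex_norm_square[symmetric]
      complex_mult_cnj cmod_power2 intro!: sum.cong)

lemma vec_cnorm_nonneg: "0 \<le> Re (y \<bullet>c (y :: complex vec))"
  using vec_cnorm_eq_sum[of y "dim_vec y"] by (simp add: sum_nonneg)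

lemma vec_cnorm_eq_0_iff:
  assumes "(y :: complex vec) \<in> carrier_vec n"
  shows "Re (y \<bullet>c y) = 0 \<longleftrightarrow> y = 0\<^sub>v n"
proof
  assume "Re (y \<bullet>c y) = 0"
  then have "\<And>i. i < n \<Longrightarrow> y $ i = 0"
    unfolding vec_cnorm_eq_sum[OF assms] by (subst (asm) sum_nonneg_eq_0_iff) auto
  then show "y = 0\<^sub>v n" using assms by auto
qed simp

text \<open>For \<open>B = 1\<close> the \<open>B\<close>-norm is the Euclidean operator norm. A
  bound on all quotients that is attained at a nonzero vector is a maximum, hence the supremum. The
  constant \<open>c\<close> refers to squared norms.\<close>

lemma Bnorm_one_eqI:
  assumes C: "C \<in> carrier_mat n n"
    and ub: "\<And>y. y \<in> carrier_vec n \<Longrightarrow> Re ((C *\<^sub>v y) \<bullet>c (C *\<^sub>v y)) \<le> c * Re (y \<bullet>c y)"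
    and x: "x \<in> carrier_vec n" "x \<noteq> 0\<^sub>v n" "Re ((C *\<^sub>v x) \<bullet>c (C *\<^sub>v x)) = c * Re (x \<bullet>c x)"
  shows "Bnorm (1\<^sub>m n) C = sqrt c"
proof -
  have pos: "Re (y \<bullet>c y) > 0" if "y \<in> carrier_vec n" "y \<noteq> 0\<^sub>v n" for y
    using vec_cnorm_eq_0_iff[OF that(1)] that(2) vec_cnorm_nonneg[of y] by linarith
  show ?thesis
    unfolding Bnorm_def
  proof (rule cSup_eq_maximum)
    have "sqrt c = Bnorm_vec (1\<^sub>m n) (C *\<^sub>v x) / Bnorm_vec (1\<^sub>m n) x"
      using C x pos[OF x(1,2)] by (simp add: Bnorm_vec_def real_sqrt_mult)
    then show "sqrt c \<in> (\<lambda>x. Bnorm_vec (1\<^sub>m n) (C *\<^sub>v x) / Bnorm_vec (1\<^sub>m n) x) `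
        (carrier_vec (dim_col C) - {0\<^sub>v (dim_col C)})"
      using C x by auto
  next
    fix r assume "r \<in> (\<lambda>x. Bnorm_vec (1\<^sub>m n) (C *\<^sub>v x) / Bnorm_vec (1\<^sub>m n) x) `
        (carrier_vec (dim_col C) - {0\<^sub>v (dim_col C)})"
    then obtain y where y: "y \<in> carrier_vec n" "y \<noteq> 0\<^sub>v n"
      "r = Bnorm_vec (1\<^sub>m n) (C *\<^sub>v y) / Bnorm_vec (1\<^sub>m n) y" using C by auto
    have "sqrt (Re ((C *\<^sub>v y) \<bullet>c (C *\<^sub>v y))) \<le> sqrt c * sqrt (Re (y \<bullet>c y))"
      using ub[OF y(1)] by (simp flip: real_sqrt_mult)
    then show "r \<le> sqrt c"
      unfolding y(3) using C y(1) pos[OF y(1,2)] by (simp add: Bnorm_vec_def divide_simps)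
  qed
qed

text \<open>By \<open>iso\<close>, \<open>V\<close> is an isometry from the Euclidean norm to the
  \<open>B\<close>-norm, so substituting \<open>x = V y\<close> turns each quotient on the left into
  the corresponding Euclidean quotient for \<open>C\<close>.\<close>

lemma Bnorm_similar:
  assumes B: "B \<in> carrier_mat n n" and V: "V \<in> carrier_mat n n" and W: "W \<in> carrier_mat n n"
    and C: "C \<in> carrier_mat n n"
    and iso: "mat_adjoint V * B * V = 1\<^sub>m n" and WV: "W * V = 1\<^sub>m n"
  shows "Bnorm B (V * C * W) = Bnorm (1\<^sub>m n) C"
proof -
  have VW: "V * W = 1\<^sub>m n" by (rule mat_mult_left_right_inverse[OF W V WV])
  have WVx: "W *\<^sub>v (V *\<^sub>v x) = x" and VWx: "V *\<^sub>v (W *\<^sub>v x) = x" if "x \<in> carrier_vec n" for x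
    using V W WV VW that by (auto simp flip: assoc_mult_mat_vec[of _ n n _ n])
  have norm: "Bnorm_vec B (V *\<^sub>v y) = Bnorm_vec (1\<^sub>m n) y" if y: "y \<in> carrier_vec n" for y
  proof -
    have "(B *\<^sub>v (V *\<^sub>v y)) \<bullet>c (V *\<^sub>v y) = (mat_adjoint V *\<^sub>v ((B * V) *\<^sub>v y)) \<bullet>c y"
      using B V y by (subst cscalar_prod_mat_adjoint[of _ n n]) auto
    also have "mat_adjoint V *\<^sub>v ((B * V) *\<^sub>v y) = (mat_adjoint V * B * V) *\<^sub>v y"
      using B V y by (simp add: assoc_mult_mat_vec[of _ n n _ n] mult_carrier_mat[of _ n n _ n])
    finally show ?thesis using y by (simp add: Bnorm_vec_def iso)
  qed
  have zero: "V *\<^sub>v y = 0\<^sub>v n \<longleftrightarrow> y = 0\<^sub>v n" if "y \<in> carrier_vec n" for y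
  proof -
    have "V *\<^sub>v 0\<^sub>v n = 0\<^sub>v n" using V by (intro eq_vecI) auto
    moreover have "W *\<^sub>v 0\<^sub>v n = 0\<^sub>v n" using W by (intro eq_vecI) auto
    ultimately show ?thesis using WVx[OF that] by metis
  qed
  \<comment> \<open>\<open>V\<close> permutes the nonzero vectors, which allows the supremum to be
    reindexed.\<close>
  have img: "carrier_vec n - {0\<^sub>v n} = (\<lambda>y. V *\<^sub>v y) ` (carrier_vec n - {0\<^sub>v n})"
  proof (intro equalityI subsetI)
    fix x assume x: "x \<in> carrier_vec n - {0\<^sub>v n :: complex vec}"
    then have "W *\<^sub>v x \<in> carrier_vec n" using W by (auto intro: mult_mat_vec_carrier)
    moreover from this have "W *\<^sub>v x \<noteq> 0\<^sub>v n" using zero[of "W *\<^sub>v x"] VWx x by auto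
    moreover have "x = V *\<^sub>v (W *\<^sub>v x)" using VWx[of x] x by simp
    ultimately show "x \<in> (\<lambda>y. V *\<^sub>v y) ` (carrier_vec n - {0\<^sub>v n})" by blast
  next
    fix x assume "x \<in> (\<lambda>y. V *\<^sub>v y) ` (carrier_vec n - {0\<^sub>v n})"
    then show "x \<in> carrier_vec n - {0\<^sub>v n}" using V zero by (auto intro: mult_mat_vec_carrier)
  qed
  have "(\<lambda>x. Bnorm_vec B (V * C * W *\<^sub>v x) / Bnorm_vec B x) ` (carrier_vec n - {0\<^sub>v n})
      = (\<lambda>y. Bnorm_vec B (V * C * W *\<^sub>v (V *\<^sub>v y)) / Bnorm_vec B (V *\<^sub>v y)) ` (carrier_vec n - {0\<^sub>v n})"
    by (subst (1) img) (simp only: image_image)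
  also have "\<dots> = (\<lambda>y. Bnorm_vec (1\<^sub>m n) (C *\<^sub>v y) / Bnorm_vec (1\<^sub>m n) y) ` (carrier_vec n - {0\<^sub>v n})"
    using V W C by (intro image_cong) (auto simp: norm WVx assoc_mult_mat_vec[of _ n n _ n])
  finally show ?thesis unfolding Bnorm_def using C V W by simp
qed

section \<open>Changes of basis for ranges and kernels\<close>

lemma invertible_matE:
  assumes A: "A \<in> carrier_mat n n" and "invertible_mat (A :: complex mat)"
  obtains "minv A \<in> carrier_mat n n" "A * minv A = 1\<^sub>m n" "minv A * A = 1\<^sub>m n"
  using minv_inverts[OF assms(2)] A by auto

lemma invertible_mat_injI:
  assumes A: "(A :: complex mat) \<in> carrier_mat n n"
    and inj: "\<And>x. x \<in> carrier_vec n \<Longrightarrow> A *\<^sub>v x = 0\<^sub>v n \<Longrightarrow> x = 0\<^sub>v n"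
  shows "invertible_mat A"
proof -
  have "det A \<noteq> 0" using det_0_iff_vec_prod_zero_field[OF A] inj by auto
  then have "A \<in> Units (ring_mat TYPE(complex) n ())" by (rule det_non_zero_imp_unit[OF A])
  then obtain C where "C \<in> carrier_mat n n" "A * C = 1\<^sub>m n"
    unfolding Units_def by (auto simp: ring_mat_simps)
  then show ?thesis using minv_eqI(1)[OF A] by blast
qed

lemma invertible_mat_adjoint:
  assumes A: "(A :: complex mat) \<in> carrier_mat n n" and inv: "invertible_mat A"
  shows "invertible_mat (mat_adjoint A)" and "minv (mat_adjoint A) = mat_adjoint (minv A)"
proof -
  obtain m: "minv A \<in> carrier_mat n n" and l: "minv A * A = 1\<^sub>m n"
    using A inv by (rule invertible_matE)
  have "mat_adjoint A * mat_adjoint (minv A) = 1\<^sub>m n"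
    by (simp add: l flip: mat_adjoint_mult[OF m A])
  then show "invertible_mat (mat_adjoint A)" "minv (mat_adjoint A) = mat_adjoint (minv A)"
    using minv_eqI[OF mat_adjoint_carrier[OF A] mat_adjoint_carrier[OF m]] by blast+
qed

text \<open>Each column of \<open>X\<close> has a preimage under \<open>U\<close>; these preimages
  are the columns of \<open>T\<close>.\<close>

lemma factor_through_range:
  assumes X: "X \<in> carrier_mat n k" and U: "U \<in> carrier_mat n m" and sub: "mat_range X \<subseteq> mat_range U"
  shows "\<exists>T \<in> carrier_mat m k. X = U * T"
proof -
  have "\<forall>j<k. \<exists>t \<in> carrier_vec m. col X j = U *\<^sub>v t"
  proof (intro allI impI)
    fix j assume j: "j < k"
    have "col X j = X *\<^sub>v unit_vec k j" using X j mult_mat_vec_unit[of j X] by simp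
    then have "col X j \<in> mat_range X" unfolding mat_range_def using X by auto
    then show "\<exists>t \<in> carrier_vec m. col X j = U *\<^sub>v t" using sub U unfolding mat_range_def by auto
  qed
  then obtain t where t: "\<And>j. j < k \<Longrightarrow> t j \<in> carrier_vec m" "\<And>j. j < k \<Longrightarrow> col X j = U *\<^sub>v t j"
    by metis
  define T where "T = mat_of_cols m (map t [0..<k])"
  have T: "T \<in> carrier_mat m k" unfolding T_def by (intro carrier_matI) auto
  have "X = U * T"
  proof (rule mat_col_eqI)
    fix j assume "j < dim_col (U * T)"
    then have j: "j < k" using T by simp
    have "col T j = t j" using t(1)[OF j] j by (simp add: T_def)
    then show "col X j = col (U * T) j" using t(2)[OF j] col_mult2[OF U T j] by simp
  qed (use X U T in auto)
  then show ?thesis using T by blast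
qed

text \<open>Equal ranges make \<open>X\<close> and \<open>V1\<close> factor through each other, so
  \<open>V1 = V1 * Z * T\<close>. The left inverse \<open>W1\<close> cancels \<open>V1\<close> and
  leaves \<open>Z * T = 1\<close>.\<close>

lemma range_basis_change:
  assumes X: "X \<in> carrier_mat n k" and V1: "V1 \<in> carrier_mat n k" and W1: "W1 \<in> carrier_mat k n"
    and WV: "W1 * V1 = 1\<^sub>m k" and range: "mat_range X = mat_range V1"
  obtains Z where "Z \<in> carrier_mat k k" "invertible_mat Z" "X = V1 * Z"
proof -
  obtain Z where Z: "Z \<in> carrier_mat k k" "X = V1 * Z"
    using factor_through_range[OF X V1] range by auto
  obtain T where T: "T \<in> carrier_mat k k" "V1 = X * T"
    using factor_through_range[OF V1 X] range by auto
  have "1\<^sub>m k = W1 * (V1 * Z * T)" using Z T WV by simp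
  also have "\<dots> = (W1 * V1) * (Z * T)" using Z(1) T(1) V1 W1 by (simp add: assoc_mult_mat_dim)
  also have "\<dots> = Z * T" using Z(1) T(1) by (simp add: WV)
  finally have "invertible_mat Z" using minv_eqI(1)[OF Z(1) T(1)] by simp
  then show ?thesis using that Z by blast
qed

text \<open>\<open>Y\<close> annihilates \<open>V2\<close>, so inserting the resolution of the
  identity \<open>decomp\<close> leaves \<open>Y = (Y * V1) * W1\<close>. The factor
  \<open>U = Y * V1\<close> is injective: if it kills \<open>x\<close>, then \<open>V1 x\<close>
  lies in the range of \<open>V2\<close>, where \<open>W1\<close> vanishes, yet \<open>W1\<close>
  recovers \<open>x\<close> from \<open>V1 x\<close>.\<close>

lemma kernel_basis_change:
  assumes Y: "Y \<in> carrier_mat k n" and V1: "V1 \<in> carrier_mat n k" and W1: "W1 \<in> carrier_mat k n"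
    and V2: "V2 \<in> carrier_mat n m" and W2: "W2 \<in> carrier_mat m n"
    and W1V1: "W1 * V1 = 1\<^sub>m k" and W1V2: "W1 * V2 = 0\<^sub>m k m"
    and decomp: "V1 * W1 + V2 * W2 = 1\<^sub>m n" and ker: "mat_kernel Y = mat_range V2"
  obtains U where "U \<in> carrier_mat k k" "invertible_mat U" "Y = U * W1"
proof
  have YV2: "Y * V2 = 0\<^sub>m k m"
  proof (rule mat_col_eqI)
    fix j assume j: "j < dim_col (0\<^sub>m k m :: complex mat)"
    have "col V2 j = V2 *\<^sub>v unit_vec m j" using V2 j mult_mat_vec_unit[of j V2] by simp
    then have "col V2 j \<in> mat_kernel Y" unfolding ker mat_range_def using V2 by auto
    then have "Y *\<^sub>v col V2 j = 0\<^sub>v k" using Y by (simp add: mat_kernel_def)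
    moreover have "col (Y * V2) j = Y *\<^sub>v col V2 j" using col_mult2[OF Y V2] j by simp
    ultimately show "col (Y * V2) j = col (0\<^sub>m k m) j" using j by simp
  qed (use Y V2 in auto)
  show U: "Y * V1 \<in> carrier_mat k k" using Y V1 by simp
  have "Y = Y * (V1 * W1 + V2 * W2)" using Y by (simp add: decomp)
  also have "\<dots> = Y * (V1 * W1) + Y * (V2 * W2)"
    using Y V1 W1 V2 W2 by (intro mult_add_distrib_mat) auto
  also have "Y * (V2 * W2) = Y * V2 * W2" using Y V2 W2 by simp
  also have "\<dots> = 0\<^sub>m k n" using W2 by (simp add: YV2)
  finally show "Y = Y * V1 * W1" using Y V1 W1 by simp
  show "invertible_mat (Y * V1)"
  proof (rule invertible_mat_injI[OF U])
    fix x assume x: "x \<in> carrier_vec k" "Y * V1 *\<^sub>v x = 0\<^sub>v k"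
    then have "V1 *\<^sub>v x \<in> mat_kernel Y" using Y V1 by (auto simp: mat_kernel_def)
    then obtain b where b: "b \<in> carrier_vec m" "V1 *\<^sub>v x = V2 *\<^sub>v b"
      unfolding ker mat_range_def using V2 by auto
    have "x = W1 * V1 *\<^sub>v x" using x by (simp add: W1V1)
    also have "\<dots> = W1 *\<^sub>v (V1 *\<^sub>v x)" using W1 V1 x(1) by simp
    also have "\<dots> = W1 * V2 *\<^sub>v b" using W1 V2 b by simp
    also have "\<dots> = 0\<^sub>v k" using b(1) unfolding W1V2 by (intro eq_vecI) auto
    finally show "x = 0\<^sub>v k" .
  qed
qed

text \<open>Since \<open>Y * X = U * Z\<close>, the inverse in the middle supplies exactly the
  factors that cancel \<open>Z\<close> and \<open>U\<close>. The projector therefore does not depend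
  on the bases chosen for the range of \<open>X\<close> and for the row space of
  \<open>Y\<close>.\<close>

lemma oblique_projector_factored:
  assumes V1: "V1 \<in> carrier_mat n k" and W1: "W1 \<in> carrier_mat k n" and WV: "W1 * V1 = 1\<^sub>m k"
    and Z: "Z \<in> carrier_mat k k" "invertible_mat Z" and U: "U \<in> carrier_mat k k" "invertible_mat U"
    and X: "X = V1 * Z" and Y: "Y = U * W1"
  shows "invertible_mat (Y * X)" and "X * minv (Y * X) * Y = V1 * W1"
proof -
  obtain mZ: "minv Z \<in> carrier_mat k k" and rZ: "Z * minv Z = 1\<^sub>m k" using Z by (rule invertible_matE)
  obtain mU: "minv U \<in> carrier_mat k k" and rU: "U * minv U = 1\<^sub>m k" and lU: "minv U * U = 1\<^sub>m k"
    using U by (rule invertible_matE)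
  have "Y * X = U * (W1 * V1) * Z" using X Y U(1) Z(1) V1 W1
    by (simp add: assoc_mult_mat_dim)
  then have YX: "Y * X = U * Z" using U(1) by (simp add: WV)
  have "U * Z * (minv Z * minv U) = U * (Z * minv Z) * minv U"
    using U(1) Z(1) mZ mU by (simp add: assoc_mult_mat_dim)
  also have "\<dots> = 1\<^sub>m k" using U(1) by (simp add: rZ rU)
  finally have inv: "U * Z * (minv Z * minv U) = 1\<^sub>m k" .
  note m = minv_eqI[OF _ _ inv, folded YX]
  show "invertible_mat (Y * X)" using m(1) U(1) Z(1) mZ mU YX by simp
  have "X * minv (Y * X) * Y = V1 * Z * (minv Z * minv U) * (U * W1)"
    using m(2) U(1) Z(1) mZ mU YX X Y by simp
  also have "\<dots> = V1 * (Z * minv Z) * (minv U * U) * W1"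
    using V1 W1 U(1) Z(1) mZ mU by (simp add: assoc_mult_mat_dim)
  also have "\<dots> = V1 * W1" using V1 W1 by (simp add: rZ lU)
  finally show "X * minv (Y * X) * Y = V1 * W1" .
qed

section \<open>Norms of a matrix with diagonal Gram matrix\<close>

lemma cnorm_unit_vec:
  assumes "k < n"
  shows "Re (unit_vec n k \<bullet>c (unit_vec n k :: complex vec)) = 1"
  using assms
  by (subst vec_cnorm_eq_sum[of _ n]) (auto simp: if_distrib[of "\<lambda>c. (cmod c)\<^sup>2"] cong: if_cong)

context
  fixes T :: "complex mat" and n :: nat and d :: "nat \<Rightarrow> real"
  assumes T: "T \<in> carrier_mat n n"
    and gram: "T * mat_adjoint T = mat_diag n (\<lambda>i. complex_of_real (d i))"
begin

text \<open>Moving \<open>T\<close> across the inner product gives the quadratic form of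
  \<open>T * mat_adjoint T\<close>, which is diagonal.\<close>

lemma cnorm_adjoint_eq_sum:
  assumes y: "y \<in> carrier_vec n"
  shows "Re ((mat_adjoint T *\<^sub>v y) \<bullet>c (mat_adjoint T *\<^sub>v y)) = (\<Sum>i<n. d i * (cmod (y $ i))\<^sup>2)"
proof -
  have "(T *\<^sub>v (mat_adjoint T *\<^sub>v y)) \<bullet>c y = (mat_adjoint T *\<^sub>v y) \<bullet>c (mat_adjoint T *\<^sub>v y)"
    using T y by (intro cscalar_prod_mat_adjoint[of _ n n]) (auto intro: carrier_vecI)
  moreover have "T *\<^sub>v (mat_adjoint T *\<^sub>v y) = mat_diag n (\<lambda>i. complex_of_real (d i)) *\<^sub>v y"
    using T y by (simp flip: gram add: assoc_mult_mat_vec_dim)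
  moreover have "mat_diag n (\<lambda>i. complex_of_real (d i)) *\<^sub>v y = vec n (\<lambda>i. complex_of_real (d i) * y $ i)"
    using y by (intro eq_vecI)
      (auto simp: mat_diag_def scalar_prod_def if_distrib[of "\<lambda>c. c * _"] cong: if_cong)
  moreover have "Re (vec n (\<lambda>i. complex_of_real (d i) * y $ i) \<bullet>c y) = (\<Sum>i<n. d i * (cmod (y $ i))\<^sup>2)"
    using y by (auto simp: scalar_prod_def lessThan_atLeast0 cmod_power2 intro!: sum.cong)
      (simp add: algebra_simps power2_eq_square)
  ultimately show ?thesis by simp
qed

lemma cnorm_adjoint_unit:
  assumes "k < n"
  shows "Re ((mat_adjoint T *\<^sub>v unit_vec n k) \<bullet>c (mat_adjoint T *\<^sub>v unit_vec n k)) = d k"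
  using assms
  by (subst cnorm_adjoint_eq_sum) (auto simp: if_distrib[of "\<lambda>c. _ * (cmod c)\<^sup>2"] cong: if_cong)

text \<open>\<open>d k\<close> is the squared norm of the image of the \<open>k\<close>-th unit
  vector under \<open>mat_adjoint T\<close>.\<close>

lemma gram_diag_nonneg:
  assumes "k < n"
  shows "0 \<le> d k"
  using vec_cnorm_nonneg[of "mat_adjoint T *\<^sub>v unit_vec n k"] by (simp only: cnorm_adjoint_unit[OF assms])

text \<open>The unit vectors are eigenvectors of \<open>T * mat_adjoint T\<close>. Their images
  under \<open>mat_adjoint T\<close>, where nonzero, are right singular vectors of \<open>T\<close>;
  the one for the largest \<open>d k\<close> later maximizes the norm quotients.\<close>

lemma mult_adjoint_unit:
  assumes "k < n"
  shows "T *\<^sub>v (mat_adjoint T *\<^sub>v unit_vec n k) = complex_of_real (d k) \<cdot>\<^sub>v unit_vec n k"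
proof -
  have "T *\<^sub>v (mat_adjoint T *\<^sub>v unit_vec n k) = mat_diag n (\<lambda>i. complex_of_real (d i)) *\<^sub>v unit_vec n k"
    using T by (simp flip: gram add: assoc_mult_mat_vec_dim)
  also have "\<dots> = complex_of_real (d k) \<cdot>\<^sub>v unit_vec n k"
    using assms mult_mat_vec_unit[of k "mat_diag n (\<lambda>i. complex_of_real (d i))"] by (auto simp: mat_diag_def)
  finally show ?thesis .
qed

context
  fixes k :: nat
  assumes k: "k < n" and max: "\<And>i. i < n \<Longrightarrow> d i \<le> d k"
begin

lemma cnorm_adjoint_le:
  assumes y: "y \<in> carrier_vec n"
  shows "Re ((mat_adjoint T *\<^sub>v y) \<bullet>c (mat_adjoint T *\<^sub>v y)) \<le> d k * Re (y \<bullet>c y)"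
  unfolding cnorm_adjoint_eq_sum[OF y] vec_cnorm_eq_sum[OF y] sum_distrib_left
  by (intro sum_mono mult_right_mono) (auto simp: max)

text \<open>Expanding \<open>0 \<le> \<parallel>d\<^sub>k y - T\<^sup>H T y\<parallel>\<^sup>2\<close> replaces the Cauchy-Schwarz inequality.\<close>
lemma cnorm_le:
  assumes y: "y \<in> carrier_vec n"
  shows "Re ((T *\<^sub>v y) \<bullet>c (T *\<^sub>v y)) \<le> d k * Re (y \<bullet>c y)"
proof -
  define z where "z = T *\<^sub>v y"
  define w where "w = mat_adjoint T *\<^sub>v z"
  have z: "z \<in> carrier_vec n" and w: "w \<in> carrier_vec n"
    using T y by (auto simp: z_def w_def intro: carrier_vecI)
  have w_le: "Re (w \<bullet>c w) \<le> d k * Re (z \<bullet>c z)" unfolding w_def by (rule cnorm_adjoint_le[OF z])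
  have yw: "y \<bullet>c w = z \<bullet>c z"
    unfolding w_def using cscalar_prod_mat_adjoint[OF T y z] by (simp add: z_def)
  then have wy: "w \<bullet>c y = cnj (z \<bullet>c z)"
    using y w by (metis conjugate_complex_def conjugate_conjugate_sprod conjugate_vec_sprod_comm)
  show ?thesis
  \<comment> \<open>The expansion ends with a division by \<open>d k\<close>. If
    \<open>d k = 0\<close>, then \<open>w\<close> vanishes, and with it the inner product of
    \<open>y\<close> and \<open>w\<close>, which is the squared norm of \<open>z\<close>.\<close>
  proof (cases "d k = 0")
    case True
    then have "Re (w \<bullet>c w) = 0" using w_le vec_cnorm_nonneg[of w] by simp
    then have "w = 0\<^sub>v n" using w vec_cnorm_eq_0_iff by blast
    then show ?thesis using yw y True by (simp add: z_def)
  next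
    case False
    then have pos: "d k > 0" using gram_diag_nonneg[OF k] by simp
    define c where "c = complex_of_real (d k)"
    have "(c \<cdot>\<^sub>v y - w) \<bullet>c (c \<cdot>\<^sub>v y - w) = c * c * (y \<bullet>c y) - c * (y \<bullet>c w) - c * (w \<bullet>c y) + w \<bullet>c w"
      using y w by (simp add: scalar_prod_def sum.distrib sum_subtractf sum_distrib_left algebra_simps c_def)
    then have "0 \<le> (d k)\<^sup>2 * Re (y \<bullet>c y) - 2 * d k * Re (z \<bullet>c z) + Re (w \<bullet>c w)"
      using vec_cnorm_nonneg[of "c \<cdot>\<^sub>v y - w"]
      by (simp add: yw wy c_def power2_eq_square)
    then have "d k * Re (z \<bullet>c z) \<le> d k * (d k * Re (y \<bullet>c y))"
      using w_le by (simp add: power2_eq_square algebra_simps)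
    then show ?thesis using pos by (simp add: z_def)
  qed
qed

lemma Bnorm_one_adjoint: "Bnorm (1\<^sub>m n) (mat_adjoint T) = sqrt (d k)"
proof (rule Bnorm_one_eqI)
  show "(unit_vec n k :: complex vec) \<noteq> 0\<^sub>v n" using k unit_vec_nonzero by blast
qed (use T cnorm_adjoint_le cnorm_adjoint_unit[OF k] cnorm_unit_vec[OF k] in auto)

text \<open>The bound for the product composes those for \<open>T\<close> and for its adjoint.
  Equality holds at the singular vector \<open>x\<close>, the image of a unit vector under
  \<open>mat_adjoint T\<close>: there \<open>T x = d k e\<close>, and
  \<open>mat_adjoint T * T\<close> multiplies \<open>x\<close> by \<open>d k\<close>.\<close>

lemma Bnorm_one_self: "Bnorm (1\<^sub>m n) T = sqrt (d k)"
  and Bnorm_one_self_adjoint_mult: "Bnorm (1\<^sub>m n) (mat_adjoint T * T) = d k"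
proof -
  have aT: "mat_adjoint T \<in> carrier_mat n n" using T by simp
  define e where "e = (unit_vec n k :: complex vec)"
  define x where "x = mat_adjoint T *\<^sub>v e"
  have e: "e \<in> carrier_vec n" "e \<noteq> 0\<^sub>v n" using k unit_vec_nonzero by (auto simp: e_def)
  have x: "x \<in> carrier_vec n" using aT by (auto simp: x_def e_def)
  have Nx: "Re (x \<bullet>c x) = d k" unfolding x_def e_def by (rule cnorm_adjoint_unit[OF k])
  have Tx: "T *\<^sub>v x = complex_of_real (d k) \<cdot>\<^sub>v e" unfolding x_def e_def by (rule mult_adjoint_unit[OF k])
  have scale: "Re ((complex_of_real (d k) \<cdot>\<^sub>v v) \<bullet>c (complex_of_real (d k) \<cdot>\<^sub>v v)) = (d k)\<^sup>2 * Re (v \<bullet>c v)"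
    for v :: "complex vec"
    by (simp add: conjugate_smult_vec power2_eq_square)
  have le2: "Re ((mat_adjoint T * T *\<^sub>v y) \<bullet>c (mat_adjoint T * T *\<^sub>v y)) \<le> (d k)\<^sup>2 * Re (y \<bullet>c y)"
    if y: "y \<in> carrier_vec n" for y
  proof -
    have "Re ((mat_adjoint T *\<^sub>v (T *\<^sub>v y)) \<bullet>c (mat_adjoint T *\<^sub>v (T *\<^sub>v y))) \<le> d k * Re ((T *\<^sub>v y) \<bullet>c (T *\<^sub>v y))"
      using T y by (intro cnorm_adjoint_le) auto
    also have "\<dots> \<le> d k * (d k * Re (y \<bullet>c y))"
      by (intro mult_left_mono cnorm_le y gram_diag_nonneg[OF k])
    finally show ?thesis using T aT y by (simp add: power2_eq_square mult.assoc assoc_mult_mat_vec_dim)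
  qed
  obtain v where v: "v \<in> carrier_vec n" "v \<noteq> 0\<^sub>v n"
    and Tv: "Re ((T *\<^sub>v v) \<bullet>c (T *\<^sub>v v)) = d k * Re (v \<bullet>c v)"
    and TTv: "Re ((mat_adjoint T * T *\<^sub>v v) \<bullet>c (mat_adjoint T * T *\<^sub>v v)) = (d k)\<^sup>2 * Re (v \<bullet>c v)"
  proof (cases "d k = 0")
    \<comment> \<open>Here \<open>x\<close> is zero and cannot serve as a maximizer. Both upper
      bounds are zero, however, so any nonzero vector attains them.\<close>
    case True
    have "Re ((T *\<^sub>v e) \<bullet>c (T *\<^sub>v e)) = 0"
      using cnorm_le[OF e(1)] True vec_cnorm_nonneg[of "T *\<^sub>v e"] by simp
    moreover have "Re ((mat_adjoint T * T *\<^sub>v e) \<bullet>c (mat_adjoint T * T *\<^sub>v e)) = 0"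
      using le2[OF e(1)] True vec_cnorm_nonneg[of "mat_adjoint T * T *\<^sub>v e"] by simp
    ultimately show ?thesis using that[OF e] True by simp
  next
    case False
    have "x \<noteq> 0\<^sub>v n" using Nx False by auto
    moreover have "Re ((T *\<^sub>v x) \<bullet>c (T *\<^sub>v x)) = d k * Re (x \<bullet>c x)"
      unfolding Tx scale Nx using cnorm_unit_vec[OF k] by (simp add: e_def power2_eq_square)
    moreover have TTx: "mat_adjoint T * T *\<^sub>v x = complex_of_real (d k) \<cdot>\<^sub>v x"
      using T aT x e(1) by (simp add: Tx mult_mat_vec[OF aT] assoc_mult_mat_vec_dim flip: x_def)
    moreover have "Re ((mat_adjoint T * T *\<^sub>v x) \<bullet>c (mat_adjoint T * T *\<^sub>v x)) = (d k)\<^sup>2 * Re (x \<bullet>c x)"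
      unfolding TTx by (rule scale)
    ultimately show ?thesis by (intro that[OF x])
  qed
  show "Bnorm (1\<^sub>m n) T = sqrt (d k)"
    by (rule Bnorm_one_eqI[OF T cnorm_le v Tv])
  show "Bnorm (1\<^sub>m n) (mat_adjoint T * T) = d k"
    using Bnorm_one_eqI[OF mult_carrier_mat[OF aT T] le2 v TTv] gram_diag_nonneg[OF k] by simp
qed

end

end

section \<open>Selector matrices for blocks of columns\<close>

text \<open>Columns \<open>a\<close> to \<open>b - 1\<close> of the identity, matching the half-open
  list \<open>[a..<b]\<close>; multiplying by it from the right picks out those columns.\<close>

definition cols_selector :: "nat \<Rightarrow> nat \<Rightarrow> nat \<Rightarrow> complex mat" where
  "cols_selector n a b = mat n (b - a) (\<lambda>(i, j). if i = a + j then 1 else 0)"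

lemma cols_selector_carrier [simp]: "cols_selector n a b \<in> carrier_mat n (b - a)"
  by (simp add: cols_selector_def)

lemma col_cols_selector: "j < b - a \<Longrightarrow> col (cols_selector n a b) j = unit_vec n (a + j)"
  by (rule eq_vecI) (auto simp: cols_selector_def unit_vec_def)

text \<open>This replaces lists of eigenvector columns by matrix products, so that blocks of
  \<open>V\<close> can be handled by matrix algebra.\<close>

lemma mat_of_cols_eq_mult_selector:
  assumes V: "V \<in> carrier_mat n n" and b: "b \<le> n"
  shows "mat_of_cols n (map (col V) [a..<b]) = V * cols_selector n a b"
proof (rule mat_col_eqI)
  fix j assume "j < dim_col (V * cols_selector n a b)"
  then have j: "j < b - a" by (simp add: cols_selector_def)
  have "col (V * cols_selector n a b) j = col V (a + j)"
    using col_mult2[OF V cols_selector_carrier j] V j b mult_mat_vec_unit[of "a + j" V]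
    by (simp add: col_cols_selector)
  then show "col (mat_of_cols n (map (col V) [a..<b])) j = col (V * cols_selector n a b) j"
    using j V b col_dim[of V "a + j"] by (simp add: col_mat_of_cols del: col_dim)
qed (use V in \<open>auto simp: cols_selector_def\<close>)

lemma cols_selector_orthonormal:
  assumes "b \<le> n"
  shows "mat_adjoint (cols_selector n a b) * cols_selector n a b = 1\<^sub>m (b - a)"
    (is "?l = ?r")
proof (rule eq_matI)
  fix i j assume "i < dim_row ?r" "j < dim_col ?r"
  then have ij: "i < b - a" "j < b - a" by auto
  have "?l $$ (i, j) = (\<Sum>l<n. if l = a + i \<and> i = j then 1 else 0)"
    using ij by (auto simp: cols_selector_def scalar_prod_def lessThan_atLeast0 intro!: sum.cong)
  also have "\<dots> = ?r $$ (i, j)" using ij assms by (cases "i = j") auto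
  finally show "?l $$ (i, j) = ?r $$ (i, j)" .
qed (auto simp: cols_selector_def)

lemma cols_selector_disjoint:
  assumes "b \<le> c"
  shows "mat_adjoint (cols_selector n a b) * cols_selector n c d = 0\<^sub>m (b - a) (d - c)"
  using assms by (intro eq_matI) (auto simp: cols_selector_def scalar_prod_def intro!: sum.neutral)

lemma cols_selector_projector:
  "cols_selector n a b * mat_adjoint (cols_selector n a b)
    = mat_diag n (\<lambda>i. if a \<le> i \<and> i < b then 1 else 0)" (is "?l = ?r")
proof (rule eq_matI)
  fix i j assume "i < dim_row ?r" "j < dim_col ?r"
  then have ij: "i < n" "j < n" by (auto simp: mat_diag_def)
  have "?l $$ (i, j) = (\<Sum>l<b - a. if i = a + l \<and> j = a + l then 1 else 0)"
    using ij by (auto simp: cols_selector_def scalar_prod_def lessThan_atLeast0 intro!: sum.cong)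
  \<comment> \<open>The condition is solved for \<open>l\<close> so that at most one summand
    survives; \<open>a \<le> i\<close> is kept because subtraction on naturals truncates.\<close>
  also have "\<dots> = (\<Sum>l<b - a. if l = i - a \<and> a \<le> i \<and> i = j then 1 else 0)"
    by (intro sum.cong) auto
  also have "\<dots> = (if a \<le> i \<and> i = j \<and> i < b then 1 else 0)"
    by (cases "a \<le> i \<and> i = j") auto
  also have "\<dots> = ?r $$ (i, j)" using ij by (auto simp: mat_diag_def)
  finally show "?l $$ (i, j) = ?r $$ (i, j)" .
qed (auto simp: cols_selector_def mat_diag_def)

section \<open>Coordinates in a B-orthonormal basis\<close>

text \<open>With \<open>X = minv M * A\<close>, the factor \<open>B\<close> on the right cancels
  \<open>minv B\<close> in the first term and completes \<open>minv B * mat_adjoint X\<close> to the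
  \<open>B\<close>-adjoint of \<open>X\<close> in the other two.\<close>

lemma M_hat_inv_mult:
  assumes A: "A \<in> carrier_mat n n" and M: "M \<in> carrier_mat n n" and B: "B \<in> carrier_mat n n"
    and M_inv: "invertible_mat M" and B_inv: "invertible_mat B"
  shows "M_hat_inv A M B * B = minv M * A + B_adjoint B (minv M * A) - minv M * A * B_adjoint B (minv M * A)"
proof -
  obtain mM: "minv M \<in> carrier_mat n n" using M M_inv by (rule invertible_matE)
  obtain mB: "minv B \<in> carrier_mat n n" and lB: "minv B * B = 1\<^sub>m n" using B B_inv by (rule invertible_matE)
  define X where "X = minv M * A"
  define Y where "Y = minv B * mat_adjoint X"
  have X: "X \<in> carrier_mat n n" and Y: "Y \<in> carrier_mat n n" using mM mB A by (auto simp: X_def Y_def)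
  define N where "N = minv (mat_adjoint M)"
  have N: "N \<in> carrier_mat n n" unfolding N_def using invertible_mat_adjoint(2)[OF M M_inv] mM by simp
  have AN: "mat_adjoint A * N = mat_adjoint X"
    unfolding X_def N_def by (simp add: invertible_mat_adjoint(2)[OF M M_inv] mat_adjoint_mult[OF mM A])
  have "minv B * mat_adjoint A * N = Y" "X * minv B * mat_adjoint A * N = X * Y"
    using A N mB X by (simp_all add: Y_def assoc_mult_mat_dim AN)
  then have "M_hat_inv A M B = X * minv B + Y - X * Y"
    by (simp only: M_hat_inv_def X_def[symmetric] N_def[symmetric])
  also have "(X * minv B + Y - X * Y) * B = (X * minv B + Y) * B - X * Y * B"
    using X Y mB B by (intro minus_mult_distrib_mat[of _ n n]) auto
  also have "(X * minv B + Y) * B = X * minv B * B + Y * B"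
    using X Y mB B by (intro add_mult_distrib_mat[of _ n n]) auto
  also have "X * minv B * B = X" using X mB B by (simp add: lB)
  also have "X * Y * B = X * (Y * B)" using X Y B by simp
  finally show ?thesis unfolding B_adjoint_def X_def[symmetric] Y_def[symmetric] .
qed

text \<open>The columns of \<open>V\<close> form a \<open>B\<close>-orthonormal basis, and
  \<open>W\<close> maps a vector to its coordinates in it. A matrix with coordinates
  \<open>C\<close> is written \<open>V * C * W\<close>.\<close>

locale B_unitary_frame =
  fixes n :: nat and B V W :: "complex mat"
  assumes B: "B \<in> carrier_mat n n" and B_self_adjoint: "mat_adjoint B = B"
    and V: "V \<in> carrier_mat n n" and B_orthonormal: "mat_adjoint V * B * V = 1\<^sub>m n"
    and W_def: "W = mat_adjoint V * B"
begin

lemma W: "W \<in> carrier_mat n n"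
  unfolding W_def using B V by (intro mult_carrier_mat[of _ n n]) auto

lemma WV: "W * V = 1\<^sub>m n"
  by (simp add: W_def B_orthonormal)

lemma VW: "V * W = 1\<^sub>m n"
  by (rule mat_mult_left_right_inverse[OF W V WV])

lemma minv_V: "minv V = W"
  by (rule minv_eqI(2)[OF V W VW])

text \<open>Only the row dimension of \<open>C\<close> is constrained, so the rule cancels inside
  right-nested products whose tail may be rectangular.\<close>

lemma VW_cancel:
  assumes "dim_row C = n"
  shows "V * (W * C) = C"
  using assoc_mult_mat_dim[of V W C] left_mult_one_mat[OF carrier_matI[OF assms refl]] assms V W
  by (simp add: VW)

lemma WV_cancel:
  assumes "dim_row C = n"
  shows "W * (V * C) = C"
  using assoc_mult_mat_dim[of W V C] left_mult_one_mat[OF carrier_matI[OF assms refl]] assms V W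
  by (simp add: WV)

text \<open>\<open>V * W = 1\<close> already exhibits \<open>V * mat_adjoint V\<close> as a left
  inverse of \<open>B\<close>. The invertibility of \<open>B\<close> and the formula for
  \<open>minv B\<close> are read off from this.\<close>

lemma B_mult_VV: "B * (V * mat_adjoint V) = 1\<^sub>m n"
proof (rule mat_mult_left_right_inverse)
  show "V * mat_adjoint V * B = 1\<^sub>m n" using V B VW by (simp add: W_def assoc_mult_mat_dim)
qed (use V B in \<open>auto intro: mult_carrier_mat[of _ n n]\<close>)

lemma B_invertible: "invertible_mat B"
  and minv_B: "minv B = V * mat_adjoint V"
  using minv_eqI[OF B _ B_mult_VV] V by (auto intro: mult_carrier_mat[of _ n n])

lemma mat_adjoint_W: "mat_adjoint W = B * V"
  using V B by (simp add: W_def mat_adjoint_mult[of _ n n] B_self_adjoint)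

text \<open>Substituting \<open>mat_adjoint W = B * V\<close> and the formula for
  \<open>minv B\<close> leaves the factor \<open>mat_adjoint V * B * V = 1\<close> in the middle. In
  these coordinates \<open>B\<close>-adjoints are conjugate transposes.\<close>

lemma B_adjoint_similar:
  assumes C: "C \<in> carrier_mat n n"
  shows "B_adjoint B (V * C * W) = V * mat_adjoint C * W"
proof -
  have "mat_adjoint (V * C * W) = mat_adjoint W * mat_adjoint C * mat_adjoint V"
    using C V W mat_adjoint_mult[OF mult_carrier_mat[OF V C] W] mat_adjoint_mult[OF V C]
    by (simp add: assoc_mult_mat_dim)
  then have "B_adjoint B (V * C * W) = V * (mat_adjoint V * B * V) * mat_adjoint C * (mat_adjoint V * B)"
    using C V B by (simp add: B_adjoint_def minv_B mat_adjoint_W assoc_mult_mat_dim)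
  then show ?thesis using V by (simp add: B_orthonormal W_def)
qed

lemma similar_coordinates:
  assumes "C \<in> carrier_mat n n"
  shows "C = V * (W * C * V) * W"
  using assms V W VW by (simp add: assoc_mult_mat_dim VW_cancel)

lemma similar_one_minus:
  assumes C: "C \<in> carrier_mat n n"
  shows "1\<^sub>m n - V * C * W = V * (1\<^sub>m n - C) * W"
proof -
  have "V * (1\<^sub>m n - C) = V * 1\<^sub>m n - V * C"
    using C V by (intro mult_minus_distrib_mat) auto
  moreover have "(V - V * C) * W = V * W - V * C * W"
    using C V W by (intro minus_mult_distrib_mat) auto
  ultimately show ?thesis using V by (simp add: VW)
qed

lemma similar_mult:
  assumes "C \<in> carrier_mat n n" "D \<in> carrier_mat n n"
  shows "V * C * W * (V * D * W) = V * (C * D) * W"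
  using assms V W by (simp add: assoc_mult_mat_dim WV_cancel)

lemma similar_inj:
  assumes C: "C \<in> carrier_mat n n" and D: "D \<in> carrier_mat n n" and eq: "V * C * W = V * D * W"
  shows "C = D"
proof -
  have "W * (V * C * W) * V = W * (V * D * W) * V" by (simp add: eq)
  then show ?thesis using C D V W by (simp add: assoc_mult_mat_dim WV_cancel WV)
qed

lemma Bnorm_similar_one:
  "C \<in> carrier_mat n n \<Longrightarrow> Bnorm B (V * C * W) = Bnorm (1\<^sub>m n) C"
  by (rule Bnorm_similar[OF B V W _ B_orthonormal WV])

end

lemma one_minus_mult_one_minus:
  assumes X: "(X :: complex mat) \<in> carrier_mat n n" and Y: "Y \<in> carrier_mat n n"
  shows "(1\<^sub>m n - X) * (1\<^sub>m n - Y) = 1\<^sub>m n - (X + Y - X * Y)"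
proof -
  have "(1\<^sub>m n - X) * (1\<^sub>m n - Y) = (1\<^sub>m n - X) - (1\<^sub>m n - X) * Y"
    using X Y by (subst mult_minus_distrib_mat[of _ n n]) auto
  also have "(1\<^sub>m n - X) * Y = Y - X * Y"
    using X Y by (subst minus_mult_distrib_mat[of _ n n]) auto
  also have "1\<^sub>m n - X - (Y - X * Y) = 1\<^sub>m n - (X + Y - X * Y)"
    using X Y by (intro eq_matI) auto
  finally show ?thesis .
qed

section \<open>The coarse-grid correction and the error propagators in coordinates\<close>

context B_unitary_frame
begin

text \<open>The first \<open>k\<close> columns \<open>V * J\<close> of \<open>V\<close> and the
  first \<open>k\<close> rows of \<open>W\<close> are dual bases. The range condition fixes
  \<open>P\<close> up to an invertible factor on the right, the kernel condition fixes
  \<open>Y\<close> up to one on the left.\<close>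

lemma coarse_factorization:
  assumes k: "k \<le> n" and P: "P \<in> carrier_mat n k" and Y: "Y \<in> carrier_mat k n"
    and range: "mat_range P = mat_range (mat_of_cols n (map (col V) [0..<k]))"
    and ker: "mat_kernel Y = mat_range (mat_of_cols n (map (col V) [k..<n]))"
  obtains Z U where "Z \<in> carrier_mat k k" "invertible_mat Z" "U \<in> carrier_mat k k" "invertible_mat U"
    "P = V * cols_selector n 0 k * Z" "Y = U * (mat_adjoint (cols_selector n 0 k) * W)"
proof -
  define J where "J = cols_selector n 0 k"
  define J' where "J' = cols_selector n k n"
  have J: "J \<in> carrier_mat n k" and J': "J' \<in> carrier_mat n (n - k)"
    using cols_selector_carrier[of n 0 k] by (simp_all add: J_def J'_def)
  have aJ: "mat_adjoint J \<in> carrier_mat k n" and aJ': "mat_adjoint J' \<in> carrier_mat (n - k) n"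
    using J J' by simp_all
  note c = mult_carrier_mat[OF V J] mult_carrier_mat[OF V J'] mult_carrier_mat[OF aJ W] mult_carrier_mat[OF aJ' W]
  have "mat_adjoint J * J = 1\<^sub>m k"
    using cols_selector_orthonormal[of k n 0] k by (simp add: J_def)
  then have WV1: "mat_adjoint J * W * (V * J) = 1\<^sub>m k"
    using J aJ V W by (simp add: assoc_mult_mat_dim WV_cancel)
  have "mat_adjoint J * J' = 0\<^sub>m k (n - k)"
    using cols_selector_disjoint[of k k n 0 n] by (simp add: J_def J'_def)
  then have WV2: "mat_adjoint J * W * (V * J') = 0\<^sub>m k (n - k)"
    using J J' V W by (simp add: assoc_mult_mat_dim WV_cancel)
  \<comment> \<open>The coordinate projectors of the two blocks add up to the identity; conjugating
    by \<open>V\<close> and \<open>W\<close> gives the decomposition required for the kernel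
    condition.\<close>
  have "J * mat_adjoint J + J' * mat_adjoint J' = 1\<^sub>m n"
    unfolding J_def J'_def cols_selector_projector by (rule eq_matI) (auto simp: mat_diag_def)
  then have "V * (J * mat_adjoint J + J' * mat_adjoint J') * W = 1\<^sub>m n"
    using V by (simp add: VW)
  moreover have "V * (J * mat_adjoint J + J' * mat_adjoint J')
      = V * (J * mat_adjoint J) + V * (J' * mat_adjoint J')"
    using V J J' aJ aJ' by (intro mult_add_distrib_mat[of _ n n _ n] mult_carrier_mat[OF J aJ] mult_carrier_mat[OF J' aJ'])
  moreover have "(V * (J * mat_adjoint J) + V * (J' * mat_adjoint J')) * W
      = V * (J * mat_adjoint J) * W + V * (J' * mat_adjoint J') * W"
    using V W mult_carrier_mat[OF J aJ] mult_carrier_mat[OF J' aJ']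
    by (intro add_mult_distrib_mat[of _ n n _ _ n] mult_carrier_mat[of V n n])
  ultimately have decomp: "V * J * (mat_adjoint J * W) + V * J' * (mat_adjoint J' * W) = 1\<^sub>m n"
    using V W J J' aJ aJ' by (simp add: assoc_mult_mat_dim)
  have V1: "mat_of_cols n (map (col V) [0..<k]) = V * J"
    and V2: "mat_of_cols n (map (col V) [k..<n]) = V * J'"
    unfolding J_def J'_def using V k by (simp_all add: mat_of_cols_eq_mult_selector)
  obtain Z where "Z \<in> carrier_mat k k" "invertible_mat Z" "P = V * J * Z"
    by (rule range_basis_change[OF P c(1) c(3) WV1 range[unfolded V1]])
  moreover obtain U where "U \<in> carrier_mat k k" "invertible_mat U" "Y = U * (mat_adjoint J * W)"
    by (rule kernel_basis_change[OF Y c(1) c(3) c(2) c(4) WV1 WV2 decomp ker[unfolded V2]])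
  ultimately show ?thesis using that unfolding J_def by blast
qed

text \<open>The coarse projection is the oblique projector built from \<open>P\<close> and
  \<open>Y = mat_adjoint R * A\<close>, so \<open>Z\<close> and \<open>U\<close> cancel. Pairs
  \<open>P\<close>, \<open>R\<close> that differ only in these factors share one projector.\<close>

lemma cgc_proj_factored:
  assumes k: "k \<le> n" and A: "A \<in> carrier_mat n n" and R: "R \<in> carrier_mat n k"
    and Z: "Z \<in> carrier_mat k k" "invertible_mat Z" and U: "U \<in> carrier_mat k k" "invertible_mat U"
    and P_eq: "P = V * cols_selector n 0 k * Z"
    and Y_eq: "mat_adjoint R * A = U * (mat_adjoint (cols_selector n 0 k) * W)"
  shows "invertible_mat (mat_adjoint R * A * P)"
    and "cgc_proj A P R = V * mat_diag n (\<lambda>i. if i < k then 1 else 0) * W"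
proof -
  define J where "J = cols_selector n 0 k"
  have J: "J \<in> carrier_mat n k" using cols_selector_carrier[of n 0 k] by (simp add: J_def)
  have aJ: "mat_adjoint J \<in> carrier_mat k n" using J by simp
  have "mat_adjoint J * J = 1\<^sub>m k"
    using cols_selector_orthonormal[of k n 0] k by (simp add: J_def)
  then have WV1: "mat_adjoint J * W * (V * J) = 1\<^sub>m k"
    using J aJ V W by (simp add: assoc_mult_mat_dim WV_cancel)
  note f = oblique_projector_factored[OF mult_carrier_mat[OF V J] mult_carrier_mat[OF aJ W] WV1 Z U
      P_eq[folded J_def] Y_eq[folded J_def]]
  show inv: "invertible_mat (mat_adjoint R * A * P)" by (rule f(1))
  have P: "P \<in> carrier_mat n k" unfolding P_eq J_def[symmetric]
    by (intro mult_carrier_mat[OF _ Z(1)] mult_carrier_mat[OF V J])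
  have Y: "mat_adjoint R * A \<in> carrier_mat k n" using R A by (intro mult_carrier_mat[of _ k n]) auto
  obtain m: "minv (mat_adjoint R * A * P) \<in> carrier_mat k k"
    using mult_carrier_mat[OF Y P] inv by (rule invertible_matE)
  have "cgc_proj A P R = P * minv (mat_adjoint R * A * P) * (mat_adjoint R * A)"
    unfolding cgc_proj_def by (rule assoc_mult_mat_dim) (use R A m in auto)
  also have "\<dots> = V * J * (mat_adjoint J * W)" by (rule f(2))
  also have "\<dots> = V * (J * mat_adjoint J) * W" using V W J aJ by (simp add: assoc_mult_mat_dim)
  also have "J * mat_adjoint J = mat_diag n (\<lambda>i. if i < k then 1 else 0)"
    unfolding J_def cols_selector_projector by simp
  finally show "cgc_proj A P R = V * mat_diag n (\<lambda>i. if i < k then 1 else 0) * W" .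
qed

text \<open>The propagators have coordinates \<open>mat_adjoint T\<close>, \<open>T\<close> and
  \<open>mat_adjoint T * T\<close> for \<open>T = S * K\<close>. The Gram matrix of \<open>T\<close>
  is that of \<open>K\<close> with its first \<open>k\<close> diagonal entries set to zero, so its
  largest entry is \<open>d k\<close>.\<close>

lemma Bnorm_E_plus:
  assumes A: "A \<in> carrier_mat n n" and X: "minv M * A \<in> carrier_mat n n"
    and K_def: "K = 1\<^sub>m n - W * (minv M * A) * V"
    and gram: "K * mat_adjoint K = mat_diag n (\<lambda>i. complex_of_real (d i))"
    and k: "k < n" and d: "\<And>i j. i \<le> j \<Longrightarrow> j < n \<Longrightarrow> d j \<le> d i"
    and proj: "cgc_proj A P R = V * mat_diag n (\<lambda>i. if i < k then 1 else 0) * W"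
  shows "Bnorm B (E_plus A M B 0 1 P R) = sqrt (d k)"
    and "Bnorm B (E_plus A M B 1 0 P R) = sqrt (d k)"
    and "Bnorm B (E_plus A M B 1 1 P R) = d k"
proof -
  define s :: "nat \<Rightarrow> real" where "s i = (if i < k then 0 else 1)" for i
  define S where "S = mat_diag n (\<lambda>i. complex_of_real (s i))"
  define L where "L = W * (minv M * A) * V"
  have L: "L \<in> carrier_mat n n" unfolding L_def by (intro mult_carrier_mat[OF _ V] mult_carrier_mat[OF W X])
  have S: "S \<in> carrier_mat n n" by (simp add: S_def)
  have K_eq: "K = 1\<^sub>m n - L" by (simp add: K_def L_def)
  have K: "K \<in> carrier_mat n n" using L by (simp add: K_eq minus_carrier_mat)
  have aK: "mat_adjoint K \<in> carrier_mat n n" using K by simp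
  have aK_eq: "mat_adjoint K = 1\<^sub>m n - mat_adjoint L"
    using L by (simp add: K_eq mat_adjoint_minus[of _ n n])
  have X_eq: "minv M * A = V * L * W" unfolding L_def by (rule similar_coordinates[OF X])
  have G: "1\<^sub>m n - minv M * A = V * K * W"
    unfolding X_eq K_eq by (rule similar_one_minus[OF L])
  have G': "1\<^sub>m n - B_adjoint B (minv M * A) = V * mat_adjoint K * W"
    unfolding X_eq aK_eq B_adjoint_similar[OF L] by (rule similar_one_minus) (use L in simp)
  have "1\<^sub>m n - mat_diag n (\<lambda>i. if i < k then 1 else 0) = S"
    by (rule eq_matI) (auto simp: S_def s_def mat_diag_def)
  then have proj': "1\<^sub>m n - cgc_proj A P R = V * S * W"
    unfolding proj using similar_one_minus[of "mat_diag n (\<lambda>i. if i < k then 1 else 0)"] by simp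
  define T where "T = S * K"
  have T: "T \<in> carrier_mat n n" unfolding T_def by (rule mult_carrier_mat[OF S K])
  have aS: "mat_adjoint S = S" unfolding S_def by (rule mat_adjoint_diag_real)
  have aT: "mat_adjoint T = mat_adjoint K * S"
    unfolding T_def mat_adjoint_mult[OF S K] aS ..
  have SS: "S * S = S" unfolding S_def by (auto simp: s_def intro!: arg_cong[of _ _ "mat_diag n"])
  have "T * mat_adjoint T = S * (K * mat_adjoint K) * S"
    unfolding aT unfolding T_def using S K aK by (simp add: assoc_mult_mat_dim)
  then have gramT: "T * mat_adjoint T = mat_diag n (\<lambda>i. complex_of_real (s i * d i * s i))"
    unfolding gram S_def by simp
  \<comment> \<open>Needed so that the zeros in the first \<open>k\<close> positions do not exceed
    \<open>d k\<close>.\<close>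
  have "0 \<le> d k" by (rule gram_diag_nonneg[OF K gram k])
  then have max: "s i * d i * s i \<le> s k * d k * s k" if "i < n" for i
    using d[of k i] that by (auto simp: s_def)
  have sk: "s k * d k * s k = d k" by (simp add: s_def)
  note norms = Bnorm_one_self[OF T gramT k max] Bnorm_one_adjoint[OF T gramT k max]
    Bnorm_one_self_adjoint_mult[OF T gramT k max]
  have pow: "Q ^\<^sub>m 0 = 1\<^sub>m n" "Q ^\<^sub>m 1 = Q" if "Q \<in> carrier_mat n n" for Q :: "complex mat"
    using that by auto
  have VCW: "V * C * W \<in> carrier_mat n n" if "C \<in> carrier_mat n n" for C
    using that V W by (intro mult_carrier_mat[OF _ W] mult_carrier_mat[OF V])
  have n: "dim_row A = n" using A by simp
  note E = E_plus_def Let_def n G G' proj' pow[OF VCW[OF K]] pow[OF VCW[OF aK]]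
    similar_mult[OF aK S] similar_mult[OF S K]
    left_mult_one_mat[OF VCW[OF S]] right_mult_one_mat[OF VCW[OF S]]
    right_mult_one_mat[OF VCW[OF mult_carrier_mat[OF aK S]]]
  have "E_plus A M B 0 1 P R = V * mat_adjoint T * W" unfolding E aT ..
  then show "Bnorm B (E_plus A M B 0 1 P R) = sqrt (d k)"
    using Bnorm_similar_one[of "mat_adjoint T"] T norms(2) sk by simp
  have "E_plus A M B 1 0 P R = V * T * W" unfolding E T_def ..
  then show "Bnorm B (E_plus A M B 1 0 P R) = sqrt (d k)"
    using Bnorm_similar_one[of T] T norms(1) sk by simp
  \<comment> \<open>\<open>S\<close> is an idempotent Hermitian matrix, so the single
    \<open>S\<close> of the two-sided propagator can be shared between both factors.\<close>
  have "mat_adjoint T * T = mat_adjoint K * S * K"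
    unfolding aT unfolding T_def using S K aK assoc_mult_mat[OF S S K] by (simp add: assoc_mult_mat_dim SS)
  then have "E_plus A M B 1 1 P R = V * (mat_adjoint T * T) * W"
    unfolding E using similar_mult[OF mult_carrier_mat[OF aK S] K] by simp
  then show "Bnorm B (E_plus A M B 1 1 P R) = d k"
    using Bnorm_similar_one[of "mat_adjoint T * T"] T norms(3) sk mult_carrier_mat[OF mat_adjoint_carrier[OF T] T]
    by simp
qed

end

theorem theorem4p1:
  fixes n n\<^sub>c :: nat
    and A M B V P R P\<^sub>s R\<^sub>s :: "complex mat"
    and \<mu> :: "nat \<Rightarrow> real"
  assumes "1 \<le> n\<^sub>c" and "n\<^sub>c < n"
    and "A \<in> carrier_mat n n" and "invertible_mat A"
    and "M \<in> carrier_mat n n" and "invertible_mat M"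
    and "B \<in> carrier_mat n n" and "hermitian_posdef B"
    and "Bnorm B (1\<^sub>m n - minv M * A) < 1"
    and "B_unitary_diagonalization B (M_hat_inv A M B * B) V
           (mat_diag n (\<lambda>i. complex_of_real (\<mu> i)))"
    and "\<forall>i j. i \<le> j \<and> j < n \<longrightarrow> \<mu> i \<le> \<mu> j"
    and "P \<in> carrier_mat n n\<^sub>c" and "R \<in> carrier_mat n n\<^sub>c"
    and "mat_range P = mat_range (mat_of_cols n (map (col V) [0..<n\<^sub>c]))"
    and "mat_kernel (mat_adjoint R * A) = mat_range (mat_of_cols n (map (col V) [n\<^sub>c..<n]))"
    and "P\<^sub>s = minv B * mat_adjoint A * R"
    and "R\<^sub>s = minv (mat_adjoint A) * B * P"
  shows "invertible_mat (mat_adjoint R * A * P)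
       \<and> invertible_mat (mat_adjoint R * A * P\<^sub>s)
       \<and> invertible_mat (mat_adjoint R\<^sub>s * A * P)
       \<and> (\<forall>(\<nu>1, \<nu>2) \<in> {(0, 1), (1, 0), (1, 1)}.
            (Bnorm B (E_plus A M B \<nu>1 \<nu>2 P R))\<^sup>2 = (Bnorm B (E_plus A M B \<nu>1 \<nu>2 P\<^sub>s R))\<^sup>2
          \<and> (Bnorm B (E_plus A M B \<nu>1 \<nu>2 P\<^sub>s R))\<^sup>2 = (Bnorm B (E_plus A M B \<nu>1 \<nu>2 P R\<^sub>s))\<^sup>2
          \<and> (Bnorm B (E_plus A M B \<nu>1 \<nu>2 P R\<^sub>s))\<^sup>2 = (1 - \<mu> n\<^sub>c) ^ (\<nu>1 + \<nu>2)
          \<and> (1 - \<mu> n\<^sub>c) ^ (\<nu>1 + \<nu>2) < 1)"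
proof -
  note A = assms(3) and M = assms(5) and B = assms(7) and P = assms(12) and R = assms(13)
  define D where "D = mat_diag n (\<lambda>i. complex_of_real (\<mu> i))"
  have diag: "B_unitary B V" "M_hat_inv A M B * B = V * D * minv V"
    using assms(10) by (auto simp: B_unitary_diagonalization_def D_def)
  define W where "W = mat_adjoint V * B"
  interpret B_unitary_frame n B V W
    using B assms(8) diag(1) by unfold_locales (auto simp: B_unitary_def hermitian_posdef_def W_def)
  obtain mM: "minv M \<in> carrier_mat n n" using M assms(6) by (rule invertible_matE)
  obtain mA: "minv A \<in> carrier_mat n n" and lA: "minv A * A = 1\<^sub>m n"
    using A assms(4) by (rule invertible_matE)
  have X: "minv M * A \<in> carrier_mat n n" by (rule mult_carrier_mat[OF mM A])
  define L where "L = W * (minv M * A) * V"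
  define K where "K = 1\<^sub>m n - L"
  define d where "d i = 1 - \<mu> i" for i
  have D: "D \<in> carrier_mat n n" by (simp add: D_def)
  have L: "L \<in> carrier_mat n n" unfolding L_def by (intro mult_carrier_mat[OF _ V] mult_carrier_mat[OF W X])
  have aL: "mat_adjoint L \<in> carrier_mat n n" using L by simp
  have K: "K \<in> carrier_mat n n" using L by (simp add: K_def minus_carrier_mat)
  have aK: "mat_adjoint K = 1\<^sub>m n - mat_adjoint L"
    using L by (simp add: K_def mat_adjoint_minus[of _ n n])
  have X_eq: "minv M * A = V * L * W" unfolding L_def by (rule similar_coordinates[OF X])
  have VCW: "V * C * W \<in> carrier_mat n n" if "C \<in> carrier_mat n n" for C
    using that by (intro mult_carrier_mat[OF _ W] mult_carrier_mat[OF V])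
  \<comment> \<open>In coordinates, \<open>(I - X)(I - X^+)\<close> with
    \<open>X = minv M * A\<close> is \<open>K * mat_adjoint K\<close>, while the given
    diagonalization turns the same matrix into \<open>1 - D\<close>. Comparing coordinates yields
    the diagonal Gram matrix.\<close>
  have "V * (K * mat_adjoint K) * W = V * K * W * (V * mat_adjoint K * W)"
    using K by (simp only: similar_mult mat_adjoint_carrier)
  also have "\<dots> = (1\<^sub>m n - V * L * W) * (1\<^sub>m n - V * mat_adjoint L * W)"
    unfolding aK unfolding K_def by (simp only: similar_one_minus L aL)
  also have "\<dots> = 1\<^sub>m n - M_hat_inv A M B * B"
    unfolding M_hat_inv_mult[OF A M B assms(6) B_invertible] X_eq B_adjoint_similar[OF L]
    by (rule one_minus_mult_one_minus[OF VCW[OF L] VCW[OF aL]])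
  also have "\<dots> = V * (1\<^sub>m n - D) * W"
    unfolding diag(2) minv_V by (rule similar_one_minus[OF D])
  finally have "K * mat_adjoint K = 1\<^sub>m n - D"
    using similar_inj[OF mult_carrier_mat[OF K mat_adjoint_carrier[OF K]] _] D
    by (simp add: minus_carrier_mat)
  also have "\<dots> = mat_diag n (\<lambda>i. complex_of_real (d i))"
    by (rule eq_matI) (auto simp: D_def d_def mat_diag_def)
  finally have gram: "K * mat_adjoint K = mat_diag n (\<lambda>i. complex_of_real (d i))" .
  have d_mono: "d j \<le> d i" if "i \<le> j" "j < n" for i j using assms(11) that by (simp add: d_def)
  have d_nonneg: "0 \<le> d n\<^sub>c" by (rule gram_diag_nonneg[OF K gram assms(2)])

  \<comment> \<open>Without coarse-grid correction the largest Gram entry is \<open>d 0\<close>, so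
    the assumed norm bound says that \<open>sqrt (d 0) < 1\<close>; sortedness carries this to
    \<open>d n\<^sub>c\<close>.\<close>
  have "1\<^sub>m n - minv M * A = V * K * W" unfolding X_eq K_def by (rule similar_one_minus[OF L])
  then have "sqrt (d 0) < 1"
    using assms(9) Bnorm_similar_one[OF K] Bnorm_one_self[OF K gram, of 0] d_mono assms(2) by simp
  moreover have "d n\<^sub>c \<le> d 0" using d_mono assms(2) by simp
  ultimately have d_less: "d n\<^sub>c < 1" by simp

  define J where "J = cols_selector n 0 n\<^sub>c"
  have J: "J \<in> carrier_mat n n\<^sub>c" using cols_selector_carrier[of n 0 n\<^sub>c] by (simp add: J_def)
  have Y: "mat_adjoint R * A \<in> carrier_mat n\<^sub>c n" using R A by (intro mult_carrier_mat[of _ _ n]) auto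
  have nc: "n\<^sub>c \<le> n" using assms(2) by simp
  obtain Z U where Z: "Z \<in> carrier_mat n\<^sub>c n\<^sub>c" "invertible_mat Z"
    and U: "U \<in> carrier_mat n\<^sub>c n\<^sub>c" "invertible_mat U"
    and P_eq: "P = V * J * Z" and Y_eq: "mat_adjoint R * A = U * (mat_adjoint J * W)"
    unfolding J_def by (rule coarse_factorization[OF nc P Y assms(14,15)])
  have aZ: "mat_adjoint Z \<in> carrier_mat n\<^sub>c n\<^sub>c" "invertible_mat (mat_adjoint Z)"
    and aU: "mat_adjoint U \<in> carrier_mat n\<^sub>c n\<^sub>c" "invertible_mat (mat_adjoint U)"
    using Z U invertible_mat_adjoint(1)[OF Z] invertible_mat_adjoint(1)[OF U] by auto

  \<comment> \<open>Taking adjoints in the factorization of \<open>mat_adjoint R * A\<close> and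
    multiplying by \<open>minv B\<close> shows that \<open>P\<^sub>s\<close> has the same basis
    \<open>V * J\<close> as \<open>P\<close>, with factor \<open>mat_adjoint U\<close> in place of
    \<open>Z\<close>.\<close>
  have "mat_adjoint A * R = mat_adjoint (mat_adjoint R * A)"
    using mat_adjoint_mult[OF mat_adjoint_carrier[OF R] A] by simp
  also have "\<dots> = mat_adjoint (mat_adjoint J * W) * mat_adjoint U"
    unfolding Y_eq using U(1) mult_carrier_mat[OF mat_adjoint_carrier[OF J] W] by (rule mat_adjoint_mult)
  also have "mat_adjoint (mat_adjoint J * W) = B * V * J"
    using mat_adjoint_mult[OF mat_adjoint_carrier[OF J] W] by (simp add: mat_adjoint_W)
  finally have AR: "mat_adjoint A * R = B * V * J * mat_adjoint U" .
  have mB: "minv B \<in> carrier_mat n n" and lB: "minv B * B = 1\<^sub>m n"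
    using minv_inverts[OF B_invertible] B by auto
  have "P\<^sub>s = minv B * (mat_adjoint A * R)"
    unfolding assms(16) using mB A R by (intro assoc_mult_mat_dim) auto
  also have "\<dots> = minv B * B * (V * J * mat_adjoint U)"
    unfolding AR using mB B V J U(1) by (simp add: assoc_mult_mat_dim)
  finally have Ps_eq: "P\<^sub>s = V * J * mat_adjoint U" using V by (simp add: lB)

  have BP: "B * P \<in> carrier_mat n n\<^sub>c" by (rule mult_carrier_mat[OF B P])
  have amA: "mat_adjoint (minv A) \<in> carrier_mat n n" using mA by simp
  have Rs_eq: "R\<^sub>s = mat_adjoint (minv A) * (B * P)"
    unfolding assms(17) invertible_mat_adjoint(2)[OF A assms(4)] using amA B P by (intro assoc_mult_mat_dim) auto
  have Rs: "R\<^sub>s \<in> carrier_mat n n\<^sub>c" unfolding Rs_eq by (rule mult_carrier_mat[OF amA BP])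
  \<comment> \<open>Dually, the inverse in \<open>R\<^sub>s\<close> cancels \<open>A\<close> and
    leaves \<open>mat_adjoint P * B\<close>, whose factorization has \<open>mat_adjoint Z\<close> in
    place of \<open>U\<close>.\<close>
  have "mat_adjoint R\<^sub>s * A = mat_adjoint (B * P) * (minv A * A)"
    unfolding Rs_eq mat_adjoint_mult[OF amA BP] using mA A B P by (simp add: assoc_mult_mat_dim)
  also have "\<dots> = mat_adjoint P * B"
    using B P by (simp add: lA mat_adjoint_mult[OF B P] B_self_adjoint)
  also have "mat_adjoint P = mat_adjoint Z * (mat_adjoint J * mat_adjoint V)"
    unfolding P_eq mat_adjoint_mult[OF mult_carrier_mat[OF V J] Z(1)] mat_adjoint_mult[OF V J] ..
  also have "\<dots> * B = mat_adjoint Z * (mat_adjoint J * W)"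
    unfolding W_def using Z(1) J V B by (simp add: assoc_mult_mat_dim)
  finally have Ys_eq: "mat_adjoint R\<^sub>s * A = mat_adjoint Z * (mat_adjoint J * W)" .

  \<comment> \<open>The invertible factors of the three pairs are \<open>Z, U\<close>, then
    \<open>mat_adjoint U, U\<close>, then \<open>Z, mat_adjoint Z\<close>.\<close>
  note c1 = cgc_proj_factored[OF nc A R Z U P_eq[unfolded J_def] Y_eq[unfolded J_def]]
  note c2 = cgc_proj_factored[OF nc A R aU U Ps_eq[unfolded J_def] Y_eq[unfolded J_def]]
  note c3 = cgc_proj_factored[OF nc A Rs Z aZ P_eq[unfolded J_def] Ys_eq[unfolded J_def]]
  note norms = Bnorm_E_plus[OF A X K_def[unfolded L_def] gram assms(2) d_mono]
  note e = norms[OF _ _ c1(2)] norms[OF _ _ c2(2)] norms[OF _ _ c3(2)]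
  \<comment> \<open>For one smoothing step the norm is a square root, for two it is
    \<open>d n\<^sub>c\<close> itself; squaring gives exponents 1 and 2. Nonnegativity of
    \<open>d n\<^sub>c\<close> is what makes its square stay below 1.\<close>
  have "(1 - \<mu> n\<^sub>c)\<^sup>2 < 1"
    using d_nonneg d_less by (simp add: d_def power_less_one_iff)
  then show ?thesis
    using c1(1) c2(1) c3(1) d_nonneg d_less e by (simp add: d_def power2_eq_square)
qed

end
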